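(* Let $H\in\mathbb{R}^{n\times n}$ be symmetric positive semidefinite, $K\in\mathbb{R}^{p\times p}$ symmetric positive definite, $\mathcal{F}:\mathbb{C}^{n\times p}\to\mathbb{R}$ differentiable, and let $X\in\mathbb{C}^{n\times p}$ satisfy $X^*HX=K$. Put $$D=GX^*H^2X-HXG^*HX,\qquad \nabla\mathcal{F}=G-HXG^*XK^{-1},$$ $$W=-(I_n-XK^{-1}X^*H)D,\qquad J=J(\tau)=K+\frac{\tau^2}{4}W^*HW+\frac{\tau}{2}X^*HD,$$ and consider the curve, for $\tau\ge0$, $$Y(\tau)=(2X+\tau W)J(\tau)^{-1}K-X .$$ Then: (i) $Y(\tau)^*HY(\tau)=K$; (ii) $Y'(0)=-D$, which is a descent direction (when $\nabla\mathcal{F}\neq0$), and $\mathcal{F}'_\tau(Y(0))\le-\frac12\|XK^{-1}\|_2^{-2}\,\|\nabla\mathcal{F}\|_F^2$; (iii) $\mathrm{cond}(J)\le\frac{5+\upsilon^2}{4}\,\mathrm{cond}(K)$, where $\upsilon=\dfrac{\tau\|H^{1/2}D\|_F}{\sqrt{\|K\|_2}}$.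
   Context: ${}^*$ denotes conjugate transpose, $\|\cdot\|_2$ the spectral norm, $\|\cdot\|_F$ the Frobenius norm, and $\mathrm{cond}(A)=\big(\lambda_{\max}(A^*A)/\lambda_{\min}(A^*A)\big)^{1/2}$. On $\mathbb{C}^{n\times p}$ (viewed as a real vector space) use the inner product $\langle A,B\rangle=\mathrm{Re}\,\mathrm{tr}(A^*B)$; $\mathcal{F}$ is differentiable in the real sense and $G\in\mathbb{C}^{n\times p}$ is its gradient at $X$ with respect to this inner product, so that the directional derivative of $\mathcal{F}$ at $X$ along $\Delta$ is $\langle G,\Delta\rangle$. $\mathcal{F}'_\tau(Y(0))=\frac{d}{d\tau}\mathcal{F}(Y(\tau))\big|_{\tau=0}$. $H^{1/2}$ is the positive semidefinite square root of $H$. The matrix $X^*HD$ is skew-Hermitian, so $J(\tau)$ is invertible and $Y(\tau)$ is well defined. *)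

theory Defs
  imports "HOL-Analysis.Analysis"
begin

text \<open>
  An \<open>m \<times> n\<close> matrix has type \<open>_^'n^'m\<close>.  On \<open>complex^'p^'n\<close> the library instances give
  \<open>norm\<close> = Frobenius norm and \<open>inner A B\<close> = \<open>Re tr (A\<^sup>* B)\<close> (lemmas \<open>norm_eq_frobenius\<close> and
  \<open>inner_eq_Re_trace\<close> below), so \<open>GDERIV F X :> G\<close> says exactly that \<open>F\<close> is real-differentiable
  at \<open>X\<close> with gradient \<open>G\<close> for the inner product \<open>Re tr (A\<^sup>* B)\<close>.
\<close>

definition ctranspose :: "complex^'n^'m \<Rightarrow> complex^'m^'n" where
  "ctranspose A = (\<chi> i j. cnj (A $ j $ i))"

abbreviation cmat :: "real^'n^'m \<Rightarrow> complex^'n^'m" where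
  "cmat \<equiv> map_matrix complex_of_real"

definition sym_psd :: "real^'n^'n \<Rightarrow> bool" where
  "sym_psd A \<longleftrightarrow> transpose A = A \<and> (\<forall>x. 0 \<le> x \<bullet> (A *v x))"

definition sym_pd :: "real^'n^'n \<Rightarrow> bool" where
  "sym_pd A \<longleftrightarrow> transpose A = A \<and> (\<forall>x. x \<noteq> 0 \<longrightarrow> 0 < x \<bullet> (A *v x))"

definition psd_sqrt :: "real^'n^'n \<Rightarrow> real^'n^'n" where
  "psd_sqrt A = (THE S. sym_psd S \<and> S ** S = A)"

text \<open>The operator norm induced by the Euclidean vector norms.\<close>

definition spectral_norm :: "complex^'n^'m \<Rightarrow> real" where
  "spectral_norm A = onorm (\<lambda>x. A *v x)"

text \<open>Only used for Hermitian matrices, all of whose eigenvalues are real.\<close>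

definition real_eigenvalues :: "complex^'n^'n \<Rightarrow> real set" where
  "real_eigenvalues M = {r. \<exists>v. v \<noteq> 0 \<and> M *v v = complex_of_real r *s v}"

definition lambda_max :: "complex^'n^'n \<Rightarrow> real" where
  "lambda_max M = Max (real_eigenvalues M)"

definition lambda_min :: "complex^'n^'n \<Rightarrow> real" where
  "lambda_min M = Min (real_eigenvalues M)"

definition cond :: "complex^'n^'n \<Rightarrow> real" where
  "cond A = sqrt (lambda_max (ctranspose A ** A) / lambda_min (ctranspose A ** A))"

text \<open>\<open>V\<close> is a descent direction of \<open>F\<close> at \<open>X\<close>: the directional derivative along \<open>V\<close> is negative.\<close>

definition descent_direction :: "('a::real_normed_vector \<Rightarrow> real) \<Rightarrow> 'a \<Rightarrow> 'a \<Rightarrow> bool" where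
  "descent_direction F X V \<longleftrightarrow>
     (\<exists>d. ((\<lambda>t. F (X + t *\<^sub>R V)) has_real_derivative d) (at 0) \<and> d < 0)"

lemma inner_eq_Re_trace:
  fixes A B :: "complex^'p^'n"
  shows "inner A B = Re (trace (ctranspose A ** B))"
proof -
  have "Re (trace (ctranspose A ** B)) = (\<Sum>j\<in>UNIV. \<Sum>i\<in>UNIV. inner (A$i$j) (B$i$j))"
    by (simp add: trace_def matrix_matrix_mult_def ctranspose_def inner_complex_def)
  also have "\<dots> = (\<Sum>i\<in>UNIV. \<Sum>j\<in>UNIV. inner (A$i$j) (B$i$j))"
    by (rule sum.swap)
  finally show ?thesis
    by (simp add: inner_vec_def)
qed

lemma norm_eq_frobenius:
  fixes A :: "complex^'p^'n"
  shows "norm A = sqrt (\<Sum>i\<in>UNIV. \<Sum>j\<in>UNIV. (cmod (A$i$j))\<^sup>2)"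
  by (simp add: norm_vec_def L2_set_def sum_nonneg)

end

theory Submission
  imports Defs
begin

text \<open>
  Writing \<open>B = G X\<^sup>* H\<close> and \<open>A = B - B\<^sup>*\<close>, which is skew-Hermitian, one has \<open>D = A H X\<close>, so that
  \<open>X\<^sup>* H D\<close> is skew-Hermitian, and \<open>\<nabla>F = A X K\<^sup>-\<^sup>1\<close>.  Since \<open>X\<^sup>* H W = 0\<close>, the matrix
  \<open>Z = 2 X + \<tau> W\<close> satisfies \<open>Z\<^sup>* H Z = 2 (J + J\<^sup>*)\<close> and \<open>Z\<^sup>* H X = 2 K\<close>, which gives the constraint.
  The slope of \<open>F\<close> along the curve is \<open>- \<langle>G, D\<rangle> = - |A|\<^sup>2 / 2\<close>, and
  \<open>|\<nabla>F| \<le> |A| |X K\<^sup>-\<^sup>1|\<close> in the Frobenius and the spectral norm.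

  For the condition number let \<open>S = H\<^sup>1\<^sup>/\<^sup>2\<close>, \<open>R = S X\<close>, \<open>E = S D\<close>, and let \<open>P = R K\<^sup>-\<^sup>1 R\<^sup>*\<close> be the
  orthogonal projection onto the range of \<open>R\<close>.  Then \<open>X\<^sup>* H D = R\<^sup>* P E\<close> and \<open>S W = - (1 - P) E\<close>, whence
  \<open>|J| \<le> |K| + \<tau>\<^sup>2 |(1 - P) E|\<^sup>2 / 4 + \<tau> |K|\<^sup>1\<^sup>/\<^sup>2 |P E| / 2\<close>; Pythagoras and AM-GM bound this by
  \<open>(5 + \<upsilon>\<^sup>2) / 4 |K|\<close>.  From below, \<open>|J x| \<ge> \<lambda>\<^sub>m\<^sub>i\<^sub>n(K) |x|\<close>, because the skew part of \<open>J\<close> does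
  not contribute to \<open>Re (x\<^sup>* J x)\<close>.
\<close>

subsection \<open>Self-adjoint maps and positive semidefinite square roots\<close>

text \<open>A maximiser of \<open>x \<bullet> f x\<close> on the compact unit sphere of
  \<open>S\<close> is an eigenvector. The real Euclidean setting covers complex vectors under the
  real part of the Hermitian product.\<close>

lemma self_adjoint_max_eigenvector:
  fixes f :: "'a::euclidean_space \<Rightarrow> 'a"
  assumes lin: "linear f" and sa: "\<And>x y. f x \<bullet> y = x \<bullet> f y"
    and S: "subspace S" "f ` S \<subseteq> S" "S \<noteq> {0}"
  obtains c v where "v \<in> S" "norm v = 1" "f v = c *\<^sub>R v" "\<And>x. x \<in> S \<Longrightarrow> x \<bullet> f x \<le> c * (norm x)\<^sup>2"
proof -
  let ?K = "S \<inter> sphere 0 1"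
  have scale: "x /\<^sub>R norm x \<in> ?K" if "x \<in> S" "x \<noteq> 0" for x
    using that S(1) by (auto intro: subspace_scale)
  obtain u where "u \<in> S" "u \<noteq> 0"
    using S(1,3) subspace_0 by blast
  with scale have ne: "?K \<noteq> {}" by blast
  have comp: "compact ?K"
    using closed_subspace[OF S(1)] by (simp add: closed_Int_compact)
  have "continuous_on ?K (\<lambda>x. x \<bullet> f x)"
    using lin by (intro continuous_intros linear_continuous_on) (simp add: linear_conv_bounded_linear)
  from continuous_attains_sup[OF comp ne this] obtain v where
    v: "v \<in> S" "norm v = 1" and max: "\<And>x. x \<in> ?K \<Longrightarrow> x \<bullet> f x \<le> v \<bullet> f v"
    by auto
  define c where "c = v \<bullet> f v"
  have bound: "x \<bullet> f x \<le> c * (norm x)\<^sup>2" if x: "x \<in> S" for x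
  proof (cases "x = 0")
    case False
    have "(x /\<^sub>R norm x) \<bullet> f (x /\<^sub>R norm x) \<le> c"
      unfolding c_def by (rule max[OF scale[OF x False]])
    also have "(x /\<^sub>R norm x) \<bullet> f (x /\<^sub>R norm x) = (x \<bullet> f x) / (norm x)\<^sup>2"
      by (simp add: linear_cmul[OF lin] power2_eq_square field_simps)
    finally show ?thesis using False by (simp add: field_simps)
  qed simp
  define w where "w = c *\<^sub>R v - f v"
  have w: "w \<in> S"
    unfolding w_def using v S(1,2) by (auto intro: subspace_diff subspace_scale)
  define q where "q = c * (norm w)\<^sup>2 - w \<bullet> f w"
  have q: "q \<ge> 0" using bound[OF w] by (simp add: q_def)
  \<comment> \<open>\<open>x \<mapsto> c |x|\<^sup>2 - x \<bullet> f x\<close> is nonnegative on \<open>S\<close> and vanishes at \<open>v\<close>, so its first variation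
      at \<open>v\<close>, in particular along its gradient direction \<open>w\<close>, vanishes.\<close>
  have var: "2 * (w \<bullet> w) \<le> s * q" if s: "s > 0" for s
  proof -
    have "(v - s *\<^sub>R w) \<bullet> f (v - s *\<^sub>R w) \<le> c * (norm (v - s *\<^sub>R w))\<^sup>2"
      using v w S(1) by (intro bound) (auto intro: subspace_diff subspace_scale)
    moreover have "v \<bullet> f w = f v \<bullet> w" by (simp add: sa)
    moreover have "v \<bullet> v = 1" using v(2) by (simp add: dot_square_norm)
    ultimately have "s * (2 * (w \<bullet> (c *\<^sub>R v - f v))) \<le> s * (s * q)"
      unfolding q_def power2_norm_eq_inner c_def
      by (simp add: linear_diff[OF lin] linear_cmul[OF lin] inner_diff_left inner_diff_right
           inner_commute algebra_simps power2_eq_square)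
    then show ?thesis
      unfolding w_def[symmetric] using s by simp
  qed
  have "w \<bullet> w = 0"
  proof (rule ccontr)
    assume "w \<bullet> w \<noteq> 0"
    then have p: "w \<bullet> w > 0" by simp
    \<comment> \<open>This choice of \<open>s\<close> makes the right-hand side at most
      \<open>w \<bullet> w\<close>; the added 1 keeps it meaningful when
      \<open>q = 0\<close>.\<close>
    have "2 * (w \<bullet> w) \<le> (w \<bullet> w) / (q + 1) * q"
      using p q by (intro var) simp
    also have "\<dots> \<le> w \<bullet> w" using p q by (simp add: field_simps)
    finally show False using p by simp
  qed
  then have "f v = c *\<^sub>R v" by (simp add: w_def)
  with v bound show ?thesis by (intro that)
qed

text \<open>Induction on the dimension: by self-adjointness, the orthogonal complement of an
  eigenvector within \<open>S\<close> is again invariant.\<close>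

lemma self_adjoint_eigenbasis:
  fixes f :: "'a::euclidean_space \<Rightarrow> 'a"
  assumes lin: "linear f" and sa: "\<And>x y. f x \<bullet> y = x \<bullet> f y"
    and "subspace S" "f ` S \<subseteq> S"
  shows "\<exists>B. finite B \<and> pairwise orthogonal B \<and> span B = S \<and> (\<forall>b\<in>B. norm b = 1 \<and> (\<exists>c. f b = c *\<^sub>R b))"
  using assms(3,4)
proof (induction "dim S" arbitrary: S rule: less_induct)
  case less
  show ?case
  proof (cases "S = {0}")
    case True
    then show ?thesis by (intro exI[of _ "{}"]) auto
  next
    case False
    obtain c v where v: "v \<in> S" "norm v = 1" "f v = c *\<^sub>R v"
      using self_adjoint_max_eigenvector[OF lin sa less.prems False] by blast
    have vv: "v \<bullet> v = 1" using v(2) by (simp add: dot_square_norm)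
    define T where "T = S \<inter> {x. v \<bullet> x = 0}"
    have T: "subspace T"
      unfolding T_def using less.prems by (intro subspace_inter subspace_hyperplane)
    have "f ` T \<subseteq> T"
    proof -
      have "v \<bullet> f x = c * (v \<bullet> x)" for x
        using sa[of v x] v(3) by simp
      then show ?thesis using less.prems by (auto simp: T_def)
    qed
    moreover have "dim T < dim S"
    proof (rule dim_psubset)
      have "v \<notin> T" using vv by (simp add: T_def)
      then have "T \<subset> S" using v(1) T_def by blast
      then show "span T \<subset> span S"
        using T less.prems(1) by (metis span_eq_iff)
    qed
    ultimately obtain B where B: "finite B" "pairwise orthogonal B" "span B = T"
      "\<forall>b\<in>B. norm b = 1 \<and> (\<exists>c. f b = c *\<^sub>R b)"
      using less.hyps T by blast
    have BT: "B \<subseteq> T" using B(3) span_superset by blast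
    have "span (insert v B) = S"
    proof
      show "span (insert v B) \<subseteq> S"
        using BT v(1) less.prems(1) by (intro span_minimal) (auto simp: T_def)
      show "S \<subseteq> span (insert v B)"
      proof
        fix x assume x: "x \<in> S"
        have "x - (v \<bullet> x) *\<^sub>R v \<in> T"
          using x v(1) less.prems(1) vv
          by (auto simp: T_def inner_diff_right intro: subspace_diff subspace_scale)
        then show "x \<in> span (insert v B)"
          using B(3) span_breakdown_eq by blast
      qed
    qed
    moreover have "pairwise orthogonal (insert v B)"
      using B(2) BT by (auto simp: pairwise_insert T_def orthogonal_def inner_commute)
    ultimately show ?thesis
      using B v by (intro exI[of _ "insert v B"]) auto
  qed
qed

text \<open>A positive semidefinite root must act as \<open>sqrt c\<close> on each eigenvector of
  \<open>h\<close> with eigenvalue \<open>c\<close>, so two roots agree on an eigenbasis of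
  \<open>h\<close>.\<close>

lemma psd_root_unique:
  fixes f g h :: "'a::euclidean_space \<Rightarrow> 'a"
  assumes lin: "linear f" "linear g" "linear h"
    and sa: "\<And>x y. f x \<bullet> y = x \<bullet> f y" "\<And>x y. g x \<bullet> y = x \<bullet> g y"
    and psd: "\<And>x. x \<bullet> f x \<ge> 0" "\<And>x. x \<bullet> g x \<ge> 0"
    and root: "\<And>x. f (f x) = h x" "\<And>x. g (g x) = h x"
  shows "f = g"
proof -
  have ev: "f v = sqrt c *\<^sub>R v"
    if "linear f" "\<And>x y. f x \<bullet> y = x \<bullet> f y" "\<And>x. x \<bullet> f x \<ge> 0" "\<And>x. f (f x) = h x" "h v = c *\<^sub>R v" "v \<noteq> 0"
    for f :: "'a \<Rightarrow> 'a" and v c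
  proof -
    have fv: "f v \<bullet> f v = c * (v \<bullet> v)"
      using that(2)[of v "f v"] that(4,5) by simp
    then have c: "c \<ge> 0"
      using that(6) by (metis inner_ge_zero inner_gt_zero_iff zero_le_mult_iff not_le)
    show ?thesis
    proof (cases "c = 0")
      case True
      with fv show ?thesis by simp
    next
      case False
      \<comment> \<open>Applying \<open>f + sqrt c\<close> to \<open>w\<close> gives
        \<open>h v - c *\<^sub>R v = 0\<close>. A nonzero \<open>w\<close> would thus be an
        eigenvector of \<open>f\<close> for the negative number \<open>- sqrt c\<close>.\<close>
      define w where "w = f v - sqrt c *\<^sub>R v"
      have "f w = - (sqrt c *\<^sub>R w)"
        using that(1,4,5) c by (simp add: w_def linear_diff linear_cmul algebra_simps)
      then have "sqrt c * (w \<bullet> w) \<le> 0" using that(3)[of w] by simp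
      then have "w = 0"
        using c False by (metis inner_gt_zero_iff mult_pos_pos not_le order_le_less real_sqrt_gt_zero)
      then show ?thesis by (simp add: w_def)
    qed
  qed
  have hsa: "h x \<bullet> y = x \<bullet> h y" for x y
    by (simp add: root(1)[symmetric] sa)
  obtain B where B: "span B = (UNIV :: 'a set)" "\<forall>b\<in>B. norm b = 1 \<and> (\<exists>c. h b = c *\<^sub>R b)"
    using self_adjoint_eigenbasis[OF lin(3) hsa, of UNIV] by auto
  have "f b = g b" if b: "b \<in> B" for b
  proof -
    obtain c where c: "h b = c *\<^sub>R b" "b \<noteq> 0" using B(2) b by fastforce
    show ?thesis
      using ev[OF lin(1) sa(1) psd(1) root(1) c] ev[OF lin(2) sa(2) psd(2) root(2) c] by simp
  qed
  then show ?thesis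
    using linear_eq_on_span[OF lin(1,2)] B(1) by (metis UNIV_I ext)
qed

text \<open>Take square roots of the eigenvalues in an orthonormal eigenbasis of \<open>h\<close>;
  they square back because the eigenvalues are nonnegative.\<close>

lemma psd_root_exists:
  fixes h :: "'a::euclidean_space \<Rightarrow> 'a"
  assumes lin: "linear h" and sa: "\<And>x y. h x \<bullet> y = x \<bullet> h y" and psd: "\<And>x. x \<bullet> h x \<ge> 0"
  shows "\<exists>f. linear f \<and> (\<forall>x y. f x \<bullet> y = x \<bullet> f y) \<and> (\<forall>x. x \<bullet> f x \<ge> 0) \<and> (\<forall>x. f (f x) = h x)"
proof -
  obtain B where B: "finite B" "pairwise orthogonal B" "span B = (UNIV :: 'a set)"
    "\<forall>b\<in>B. norm b = 1 \<and> (\<exists>c. h b = c *\<^sub>R b)"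
    using self_adjoint_eigenbasis[OF lin sa, of UNIV] by auto
  from B(4) obtain c where c: "\<And>b. b \<in> B \<Longrightarrow> norm b = 1 \<and> h b = c b *\<^sub>R b" by metis
  have c0: "c b \<ge> 0" if "b \<in> B" for b
    using psd[of b] c[OF that] by (simp add: dot_square_norm)
  define f where "f x = (\<Sum>b\<in>B. (sqrt (c b) * (b \<bullet> x)) *\<^sub>R b)" for x
  have f: "linear f"
    by (rule linearI)
       (simp_all add: f_def inner_add_right algebra_simps sum.distrib scaleR_sum_right)
  have fb: "f b = sqrt (c b) *\<^sub>R b" if b: "b \<in> B" for b
  proof -
    have "f b = (\<Sum>d\<in>B. if d = b then sqrt (c b) *\<^sub>R b else 0)"
      unfolding f_def using b B(2) c
      by (intro sum.cong) (auto simp: pairwise_def orthogonal_def dot_square_norm)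
    then show ?thesis using b B(1) by simp
  qed
  have "f (f x) = h x" for x
  proof -
    have "linear (f \<circ> f)" using f f by (rule linear_compose)
    moreover have "(f \<circ> f) b = h b" if b: "b \<in> B" for b
      using fb[OF b] c0[OF b] c[OF b] by (simp add: linear_cmul[OF f])
    ultimately show ?thesis
      using linear_eq_on_span[of "f \<circ> f" h B x] lin B(3) by simp
  qed
  moreover have "f x \<bullet> y = x \<bullet> f y" for x y
    by (simp add: f_def inner_sum_left inner_sum_right algebra_simps inner_commute)
  moreover have "x \<bullet> f x \<ge> 0" for x
    unfolding f_def inner_sum_right
    using c0 by (intro sum_nonneg) (simp add: inner_commute mult.assoc)
  ultimately show ?thesis using f by blast
qed

lemma sym_psd_iff:
  "sym_psd A \<longleftrightarrow> (\<forall>x y. (A *v x) \<bullet> y = x \<bullet> (A *v y)) \<and> (\<forall>x. x \<bullet> (A *v x) \<ge> 0)"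
proof -
  have "transpose A = A" if sa: "\<And>x y. (A *v x) \<bullet> y = x \<bullet> (A *v y)"
  proof -
    have "transpose A *v x = A *v x" for x
      by (rule vector_eq_ldot[THEN iffD1]) (metis sa dot_lmul_matrix inner_commute transpose_matrix_vector)
    then show ?thesis by (simp add: matrix_eq)
  qed
  moreover have "(A *v x) \<bullet> y = x \<bullet> (A *v y)" if "transpose A = A" for x y
    using that by (metis dot_lmul_matrix transpose_matrix_vector)
  ultimately show ?thesis unfolding sym_psd_def by blast
qed

text \<open>Existence and uniqueness of the root together justify the definite description.\<close>

lemma psd_sqrt:
  assumes "sym_psd A"
  shows "sym_psd (psd_sqrt A)" "psd_sqrt A ** psd_sqrt A = A"
proof -
  have A: "\<And>x y. (A *v x) \<bullet> y = x \<bullet> (A *v y)" "\<And>x. x \<bullet> (A *v x) \<ge> 0"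
    using assms by (simp_all add: sym_psd_iff)
  obtain f where f: "linear f" "\<And>x y. f x \<bullet> y = x \<bullet> f y" "\<And>x. x \<bullet> f x \<ge> 0" "\<And>x. f (f x) = A *v x"
    using psd_root_exists[OF matrix_vector_mul_linear A] by metis
  have mf: "matrix f *v x = f x" for x by (simp add: matrix_works f(1))
  have ex: "sym_psd (matrix f) \<and> matrix f ** matrix f = A"
    by (simp add: sym_psd_iff mf f matrix_eq flip: matrix_vector_mul_assoc)
  moreover have "S = matrix f" if S: "sym_psd S \<and> S ** S = A" for S
  proof -
    have "(*v) S = f"
      by (rule psd_root_unique[OF matrix_vector_mul_linear f(1) matrix_vector_mul_linear[of A]])
         (use S f in \<open>auto simp: sym_psd_iff matrix_vector_mul_assoc\<close>)
    then show ?thesis by (metis matrix_of_matrix_vector_mul)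
  qed
  ultimately have "sym_psd (psd_sqrt A) \<and> psd_sqrt A ** psd_sqrt A = A"
    unfolding psd_sqrt_def by (rule theI)
  then show "sym_psd (psd_sqrt A)" "psd_sqrt A ** psd_sqrt A = A" by auto
qed

subsection \<open>Complex matrices\<close>

lemma ctranspose_nth [simp]: "ctranspose A $ i $ j = cnj (A $ j $ i)"
  by (simp add: ctranspose_def)

lemma ctranspose_ctranspose [simp]: "ctranspose (ctranspose A) = A"
  by (simp add: vec_eq_iff)

lemma ctranspose_mult: "ctranspose (A ** B) = ctranspose B ** ctranspose A"
  by (simp add: vec_eq_iff matrix_matrix_mult_def mult.commute)

lemma ctranspose_add: "ctranspose (A + B) = ctranspose A + ctranspose B"
  and ctranspose_diff: "ctranspose (A - B) = ctranspose A - ctranspose B"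
  and ctranspose_scaleR: "ctranspose (r *\<^sub>R A) = r *\<^sub>R ctranspose A"
  by (simp_all add: vec_eq_iff)

lemma ctranspose_cmat: "ctranspose (cmat A) = cmat (transpose A)"
  by (simp add: vec_eq_iff transpose_def)

lemma cmat_mult: "cmat (A ** B) = cmat A ** cmat B"
  by (simp add: vec_eq_iff matrix_matrix_mult_def)

lemma Re_cmat_vector: "Re ((cmat A *v x) $ i) = (A *v (\<chi> i. Re (x $ i))) $ i"
  and Im_cmat_vector: "Im ((cmat A *v x) $ i) = (A *v (\<chi> i. Im (x $ i))) $ i"
  by (simp_all add: matrix_vector_mult_def)

text \<open>The inner product takes real parts and a real matrix does not mix real and imaginary
  parts, so no cross terms arise.\<close>

lemma inner_cmat_vector:
  "x \<bullet> (cmat A *v x) = (\<chi> i. Re (x $ i)) \<bullet> (A *v (\<chi> i. Re (x $ i)))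
     + (\<chi> i. Im (x $ i)) \<bullet> (A *v (\<chi> i. Im (x $ i)))"
  unfolding inner_vec_def
  by (simp add: inner_complex_def Re_cmat_vector Im_cmat_vector sum.distrib)

lemma inner_cmat_pos:
  assumes "sym_pd A" "x \<noteq> 0"
  shows "x \<bullet> (cmat A *v x) > 0"
proof -
  have pd: "y \<bullet> (A *v y) \<ge> 0" "y \<noteq> 0 \<Longrightarrow> y \<bullet> (A *v y) > 0" for y
    using assms(1) unfolding sym_pd_def by (cases "y = 0"; force)+
  have "(\<chi> i. Re (x $ i)) \<noteq> 0 \<or> (\<chi> i. Im (x $ i)) \<noteq> 0"
    using assms(2) by (auto simp: vec_eq_iff complex_eq_iff)
  then show ?thesis
    unfolding inner_cmat_vector using pd by (metis add_pos_nonneg add_nonneg_pos)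
qed

section \<open>Adjoints and bounds for the Frobenius norm of products\<close>

lemma inner_mult_vector: "(A *v x) \<bullet> y = x \<bullet> (ctranspose A *v y)" for A :: "complex^'n^'m"
proof -
  have "(A *v x) \<bullet> y = (\<Sum>i\<in>UNIV. \<Sum>j\<in>UNIV. (A $ i $ j * x $ j) \<bullet> (y $ i))"
    by (simp add: inner_vec_def matrix_vector_mult_def inner_sum_left)
  also have "\<dots> = (\<Sum>j\<in>UNIV. \<Sum>i\<in>UNIV. (x $ j) \<bullet> (cnj (A $ i $ j) * y $ i))"
    by (subst sum.swap) (simp add: inner_complex_def algebra_simps)
  also have "\<dots> = x \<bullet> (ctranspose A *v y)"
    by (simp add: inner_vec_def matrix_vector_mult_def inner_sum_right)
  finally show ?thesis .
qed

lemma inner_mult_matrix: "(A ** B) \<bullet> C = B \<bullet> (ctranspose A ** C)" for A :: "complex^'n^'m"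
  by (simp add: inner_eq_Re_trace ctranspose_mult matrix_mul_assoc)

lemma inner_ctranspose: "ctranspose A \<bullet> ctranspose B = A \<bullet> B"
  unfolding inner_vec_def by (subst sum.swap) (simp add: inner_complex_def)

lemma norm_ctranspose [simp]: "norm (ctranspose A) = norm A"
  by (simp add: norm_eq_sqrt_inner inner_ctranspose)

lemma norm_matrix_vector_le: "norm (A *v x) \<le> norm A * norm x" for A :: "complex^'n^'m"
proof -
  have "norm ((A *v x) $ i) \<le> norm (A $ i) * norm x" for i
  proof -
    have "norm ((A *v x) $ i) \<le> (\<Sum>j\<in>UNIV. norm (A $ i $ j * x $ j))"
      unfolding matrix_vector_mult_def by (simp add: norm_sum)
    also have "\<dots> \<le> norm (A $ i) * norm x"
      using L2_set_mult_ineq[of "\<lambda>j. norm (A $ i $ j)" "\<lambda>j. norm (x $ j)" UNIV]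
      by (simp add: norm_vec_def norm_mult)
    finally show ?thesis .
  qed
  then have "norm (A *v x) \<le> L2_set (\<lambda>i. norm (A $ i) * norm x) UNIV"
    unfolding norm_vec_def[of "A *v x"] by (intro L2_set_mono) auto
  also have "\<dots> = norm A * norm x"
    by (simp add: norm_vec_def[of A] L2_set_left_distrib)
  finally show ?thesis .
qed

lemma norm_squared_columns: "(norm A)\<^sup>2 = (\<Sum>j\<in>UNIV. (norm (column j A))\<^sup>2)"
  for A :: "complex^'n^'m"
  unfolding power2_norm_eq_inner inner_vec_def column_def
  by (subst sum.swap) simp

lemma column_mult: "column j (A ** B) = A *v column j B"
  by (simp add: vec_eq_iff column_def matrix_matrix_mult_def matrix_vector_mult_def)

text \<open>The squared Frobenius norm is a sum over columns, and \<open>A\<close> acts on each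
  column of \<open>B\<close> separately.\<close>

lemma norm_mult_left_le:
  fixes A :: "complex^'n^'m" and B :: "complex^'k^'n"
  assumes "\<And>x. norm (A *v x) \<le> c * norm x" "c \<ge> 0"
  shows "norm (A ** B) \<le> c * norm B"
proof -
  have "(norm (A ** B))\<^sup>2 \<le> (\<Sum>j\<in>UNIV. (c * norm (column j B))\<^sup>2)"
    unfolding norm_squared_columns[of "A ** B"] column_mult
    using assms(1) by (intro sum_mono power_mono) auto
  also have "\<dots> = (c * norm B)\<^sup>2"
    by (simp add: norm_squared_columns[of B] power_mult_distrib sum_distrib_left)
  finally show ?thesis
    by (rule power2_le_imp_le) (simp add: assms(2))
qed

lemma norm_matrix_mult_le: "norm (A ** B) \<le> norm A * norm B"
  for A :: "complex^'n^'m" and B :: "complex^'k^'n"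
  by (rule norm_mult_left_le[OF norm_matrix_vector_le]) simp

lemma bounded_bilinear_matrix_mult:
  "bounded_bilinear ((**) :: complex^'n^'m \<Rightarrow> complex^'k^'n \<Rightarrow> complex^'k^'m)"
proof
  fix A A' :: "complex^'n^'m" and B B' :: "complex^'k^'n" and r :: real
  show "(A + A') ** B = A ** B + A' ** B" "A ** (B + B') = A ** B + A ** B'"
    by (simp_all add: vec_eq_iff matrix_matrix_mult_def algebra_simps sum.distrib)
  show "(r *\<^sub>R A) ** B = r *\<^sub>R (A ** B)" "A ** (r *\<^sub>R B) = r *\<^sub>R (A ** B)"
    by (simp_all add: vec_eq_iff matrix_matrix_mult_def scaleR_sum_right)
  show "\<exists>K. \<forall>A B. norm ((A :: complex^'n^'m) ** (B :: complex^'k^'n)) \<le> norm A * norm B * K"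
    using norm_matrix_mult_le by (intro exI[of _ 1]) auto
qed

lemmas matrix_mult_simps =
  bounded_bilinear.add_left[OF bounded_bilinear_matrix_mult]
  bounded_bilinear.add_right[OF bounded_bilinear_matrix_mult]
  bounded_bilinear.diff_left[OF bounded_bilinear_matrix_mult]
  bounded_bilinear.diff_right[OF bounded_bilinear_matrix_mult]
  bounded_bilinear.minus_left[OF bounded_bilinear_matrix_mult]
  bounded_bilinear.minus_right[OF bounded_bilinear_matrix_mult]
  bounded_bilinear.scaleR_left[OF bounded_bilinear_matrix_mult]
  bounded_bilinear.scaleR_right[OF bounded_bilinear_matrix_mult]

lemma matrix_inv_inverse:
  fixes A :: "complex^'n^'n"
  assumes "\<forall>x. A *v x = 0 \<longrightarrow> x = 0"
  shows "A ** matrix_inv A = mat 1" "matrix_inv A ** A = mat 1"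
proof -
  have "invertible A"
    using assms matrix_left_invertible_ker[of A] by (simp add: invertible_left_inverse)
  then have "\<exists>B. A ** B = mat 1 \<and> B ** A = mat 1" unfolding invertible_def .
  from someI_ex[OF this] show "A ** matrix_inv A = mat 1" "matrix_inv A ** A = mat 1"
    unfolding matrix_inv_def by auto
qed

section \<open>The spectral norm as an operator bound\<close>

lemma norm_le_spectral_norm: "norm (A *v x) \<le> spectral_norm A * norm x"
  unfolding spectral_norm_def by (rule onorm[OF matrix_vector_mul_bounded_linear])

lemma spectral_norm_nonneg: "0 \<le> spectral_norm A"
  unfolding spectral_norm_def by (rule onorm_pos_le[OF matrix_vector_mul_bounded_linear])

text \<open>Cauchy-Schwarz bounds the square of \<open>norm (ctranspose A *v y)\<close> by a
  multiple of itself, and one factor cancels.\<close>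

lemma norm_ctranspose_vector_le:
  fixes A :: "complex^'n^'m"
  assumes "\<And>x. norm (A *v x) \<le> c * norm x" "c \<ge> 0"
  shows "norm (ctranspose A *v y) \<le> c * norm y"
proof -
  have "(norm (ctranspose A *v y))\<^sup>2 = y \<bullet> (A *v (ctranspose A *v y))"
    by (metis ctranspose_ctranspose inner_mult_vector power2_norm_eq_inner)
  also have "\<dots> \<le> norm y * norm (A *v (ctranspose A *v y))" by (rule norm_cauchy_schwarz)
  also have "\<dots> \<le> norm y * (c * norm (ctranspose A *v y))"
    by (intro mult_left_mono assms) auto
  finally have "norm (ctranspose A *v y) * norm (ctranspose A *v y)
      \<le> (c * norm y) * norm (ctranspose A *v y)"
    by (simp add: power2_eq_square algebra_simps)
  then show ?thesis
    by (cases "ctranspose A *v y = 0") (use assms(2) in auto)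
qed

lemma norm_mult_right_le: "norm (A ** B) \<le> norm A * spectral_norm B"
  for A :: "complex^'n^'m" and B :: "complex^'k^'n"
proof -
  have "norm (ctranspose B ** ctranspose A) \<le> spectral_norm B * norm (ctranspose A)"
    by (rule norm_mult_left_le[OF norm_ctranspose_vector_le[OF norm_le_spectral_norm]])
       (simp_all add: spectral_norm_nonneg)
  then show ?thesis
    by (metis ctranspose_mult norm_ctranspose mult.commute)
qed

section \<open>Eigenvalues of Hermitian matrices and the condition number\<close>

lemma scaleR_eq_vector_scale: "complex_of_real r *s v = r *\<^sub>R v"
  by (simp add: vec_eq_iff vector_scalar_mult_def scaleR_conv_of_real[where 'a = complex])

lemma inner_gram: "x \<bullet> ((ctranspose A ** A) *v y) = (A *v x) \<bullet> (A *v y)"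
  by (simp add: inner_mult_vector matrix_vector_mul_assoc)

lemma matrix_self_adjoint:
  fixes M :: "complex^'n^'n"
  assumes "ctranspose M = M"
  shows "(M *v x) \<bullet> y = x \<bullet> (M *v y)"
  by (simp add: inner_mult_vector assms)

lemma real_eigenvalues_iff: "r \<in> real_eigenvalues M \<longleftrightarrow> (\<exists>v. v \<noteq> 0 \<and> M *v v = r *\<^sub>R v)"
  by (simp add: real_eigenvalues_def scaleR_eq_vector_scale)

text \<open>Eigenvectors for distinct eigenvalues are orthogonal, hence independent. Finiteness is
  what gives \<open>Max\<close> and \<open>Min\<close> in \<open>lambda_max\<close> and
  \<open>lambda_min\<close> their meaning.\<close>

lemma finite_real_eigenvalues:
  fixes M :: "complex^'n^'n"
  assumes "ctranspose M = M"
  shows "finite (real_eigenvalues M)"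
proof -
  have "\<forall>r\<in>real_eigenvalues M. \<exists>v. v \<noteq> 0 \<and> M *v v = r *\<^sub>R v"
    by (simp add: real_eigenvalues_iff)
  then obtain v where v: "\<And>r. r \<in> real_eigenvalues M \<Longrightarrow> v r \<noteq> 0 \<and> M *v v r = r *\<^sub>R v r"
    by metis
  have orth: "v r \<bullet> v s = 0" if "r \<in> real_eigenvalues M" "s \<in> real_eigenvalues M" "r \<noteq> s" for r s
    using matrix_self_adjoint[OF assms, of "v r" "v s"] v that by simp
  have "inj_on v (real_eigenvalues M)"
    using orth v by (metis inj_onI inner_eq_zero_iff)
  moreover have "finite (v ` real_eigenvalues M)"
  proof (rule independent_imp_finite[OF pairwise_orthogonal_independent])
    show "pairwise orthogonal (v ` real_eigenvalues M)"
      using orth by (auto simp: pairwise_def orthogonal_def)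
    show "0 \<notin> v ` real_eigenvalues M" using v by force
  qed
  ultimately show ?thesis by (rule finite_imageD[rotated])
qed

lemma hermitian_extreme_eigenvectors:
  fixes M :: "complex^'n^'n"
  assumes M: "ctranspose M = M"
  obtains u v where "norm u = 1" "M *v u = lambda_max M *\<^sub>R u" "\<And>x. x \<bullet> (M *v x) \<le> lambda_max M * (norm x)\<^sup>2"
    "norm v = 1" "M *v v = lambda_min M *\<^sub>R v" "\<And>x. lambda_min M * (norm x)\<^sup>2 \<le> x \<bullet> (M *v x)"
proof -
  have ne: "(UNIV :: (complex^'n) set) \<noteq> {0}"
    using vector_choose_size[of 1] by (metis UNIV_I norm_zero singletonD zero_le_one zero_neq_one)
  obtain c u where u: "norm u = 1" "M *v u = c *\<^sub>R u" "\<And>x. x \<bullet> (M *v x) \<le> c * (norm x)\<^sup>2"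
    using self_adjoint_max_eigenvector[OF matrix_vector_mul_linear matrix_self_adjoint[OF M] subspace_UNIV subset_UNIV ne]
    by (metis UNIV_I)
  \<comment> \<open>The smallest eigenvalue is minus the largest eigenvalue of the negated
    map.\<close>
  have lin: "linear (\<lambda>x. - (M *v x))" by (simp add: linear_compose_neg)
  have sa: "- (M *v x) \<bullet> y = x \<bullet> - (M *v y)" for x y
    by (simp add: matrix_self_adjoint[OF M])
  obtain d v where v: "norm v = 1" "- (M *v v) = d *\<^sub>R v" "\<And>x. x \<bullet> (- (M *v x)) \<le> d * (norm x)\<^sup>2"
    using self_adjoint_max_eigenvector[OF lin sa subspace_UNIV subset_UNIV ne] by (metis UNIV_I)
  have v': "M *v v = (- d) *\<^sub>R v" "- d * (norm x)\<^sup>2 \<le> x \<bullet> (M *v x)" for x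
    using v(2) v(3)[of x] by (metis add.inverse_inverse scaleR_minus_left, simp)
  have eig: "c \<in> real_eigenvalues M" "- d \<in> real_eigenvalues M"
    unfolding real_eigenvalues_iff using u(1,2) v(1) v'(1) norm_zero zero_neq_one by metis+
  have "r \<le> c \<and> - d \<le> r" if r: "r \<in> real_eigenvalues M" for r
  proof -
    obtain x where "x \<noteq> 0" "M *v x = r *\<^sub>R x" using r by (auto simp: real_eigenvalues_iff)
    then have "x \<bullet> x > 0" "r * (x \<bullet> x) \<le> c * (x \<bullet> x)" "- d * (x \<bullet> x) \<le> r * (x \<bullet> x)"
      using u(3)[of x] v'(2)[of x] by (simp_all add: power2_norm_eq_inner)
    then show ?thesis by (meson mult_right_le_imp_le)
  qed
  then have "lambda_max M = c" "lambda_min M = - d"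
    unfolding lambda_max_def lambda_min_def
    using eig finite_real_eigenvalues[OF M] by (auto intro!: Max_eqI Min_eqI)
  with u v(1) v' show ?thesis by (intro that[of u v]) auto
qed

text \<open>The extreme eigenvalues of the Gram matrix are squared norms of \<open>A\<close> at unit
  eigenvectors \<open>u\<close> and \<open>v\<close>, so \<open>cond A\<close> is a quotient of two
  stretch factors.\<close>

lemma cond_le:
  fixes A :: "complex^'n^'n"
  assumes "\<And>x. norm (A *v x) \<le> b * norm x" "\<And>x. a * norm x \<le> norm (A *v x)" "a > 0"
  shows "cond A \<le> b / a"
proof -
  let ?M = "ctranspose A ** A"
  have M: "ctranspose ?M = ?M" by (simp add: ctranspose_mult)
  obtain u v where "norm u = 1" "?M *v u = lambda_max ?M *\<^sub>R u" "norm v = 1" "?M *v v = lambda_min ?M *\<^sub>R v"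
    using hermitian_extreme_eigenvectors[OF M] by metis
  then have uv: "lambda_max ?M = (norm (A *v u))\<^sup>2" "lambda_min ?M = (norm (A *v v))\<^sup>2"
    using inner_gram[of u A u] inner_gram[of v A v] by (simp_all add: dot_square_norm)
  have "cond A = norm (A *v u) / norm (A *v v)"
    unfolding cond_def uv by (simp add: real_sqrt_divide)
  also have "\<dots> \<le> b / a"
    using assms(1)[of u] assms(2)[of v] assms(3) \<open>norm u = 1\<close> \<open>norm v = 1\<close>
    by (intro frac_le) (auto intro: order_trans[OF norm_ge_zero])
  finally show ?thesis .
qed

text \<open>The counterpart of \<open>cond_le\<close>: \<open>cond A\<close> dominates every ratio
  of stretch factors. Injectivity makes the smallest eigenvalue of the Gram matrix positive; the
  product form avoids division by norms.\<close>

lemma norm_le_cond: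
  fixes A :: "complex^'n^'n"
  assumes "\<And>x. A *v x = 0 \<Longrightarrow> x = 0"
  shows "norm (A *v x) * norm y \<le> cond A * norm (A *v y) * norm x"
proof -
  let ?M = "ctranspose A ** A"
  have M: "ctranspose ?M = ?M" by (simp add: ctranspose_mult)
  obtain v where v: "norm v = 1" "?M *v v = lambda_min ?M *\<^sub>R v"
    and b: "\<And>x. x \<bullet> (?M *v x) \<le> lambda_max ?M * (norm x)\<^sup>2" "\<And>x. lambda_min ?M * (norm x)\<^sup>2 \<le> x \<bullet> (?M *v x)"
    using hermitian_extreme_eigenvectors[OF M] by metis
  have "lambda_min ?M = (norm (A *v v))\<^sup>2"
    using inner_gram[of v A v] v by (simp add: dot_square_norm)
  moreover have "A *v v \<noteq> 0" using assms v(1) by force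
  ultimately have pos: "lambda_min ?M > 0" by simp
  have max: "(norm (A *v x))\<^sup>2 \<le> lambda_max ?M * (norm x)\<^sup>2" for x
    using b(1)[of x] by (simp add: inner_gram dot_square_norm)
  have min: "lambda_min ?M * (norm x)\<^sup>2 \<le> (norm (A *v x))\<^sup>2" for x
    using b(2)[of x] by (simp add: inner_gram dot_square_norm)
  have max0: "lambda_max ?M \<ge> 0" using max[of v] v(1) by (simp add: order_trans[OF zero_le_power2])
  have "(norm (A *v x) * norm y)\<^sup>2 \<le> (lambda_max ?M * (norm x)\<^sup>2) * ((norm (A *v y))\<^sup>2 / lambda_min ?M)"
    unfolding power_mult_distrib using max[of x] min[of y] pos max0
    by (intro mult_mono) (auto simp: field_simps)
  also have "\<dots> = (cond A * norm (A *v y) * norm x)\<^sup>2"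
    using pos max0 by (simp add: cond_def power_mult_distrib)
  finally show ?thesis
    by (rule power2_le_imp_le) (use pos max0 in \<open>simp add: cond_def\<close>)
qed

subsection \<open>The Cayley-type curve\<close>

lemma norm_lower_bound:
  fixes A :: "complex^'n^'n"
  assumes "\<And>x. m * (norm x)\<^sup>2 \<le> x \<bullet> (A *v x)"
  shows "m * norm x \<le> norm (A *v x)"
proof (cases "x = 0")
  case False
  have "(m * norm x) * norm x \<le> norm (A *v x) * norm x"
    using assms[of x] norm_cauchy_schwarz[of x "A *v x"] by (simp add: power2_eq_square algebra_simps)
  then show ?thesis using False by simp
qed simp

lemma inner_skew_hermitian:
  fixes B :: "complex^'n^'n"
  assumes "ctranspose B = - B"
  shows "x \<bullet> (B *v x) = 0"
proof -
  have "- B *v x = - (B *v x)"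
    by (simp add: vec_eq_iff matrix_vector_mult_def sum_negf)
  then show ?thesis
    using inner_mult_vector[of B x x] assms by (simp add: inner_commute)
qed

lemma scaleR_matrix_vector: "(r *\<^sub>R A) *v x = r *\<^sub>R (A *v x)" for A :: "complex^'n^'m"
  by (simp add: vec_eq_iff matrix_vector_mult_def scaleR_sum_right)

text \<open>The skew term vanishes in the real quadratic form and the Gram term only adds a
  nonnegative amount, so the lower bound for \<open>k\<close> survives for \<open>t\<close> of
  either sign.\<close>

lemma perturbed_rayleigh:
  fixes k B :: "complex^'p^'p" and V :: "complex^'p^'n"
  assumes "\<And>x. m * (norm x)\<^sup>2 \<le> x \<bullet> (k *v x)" "ctranspose B = - B" "r \<ge> 0"
  shows "m * (norm x)\<^sup>2 \<le> x \<bullet> ((k + r *\<^sub>R (ctranspose V ** V) + t *\<^sub>R B) *v x)"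
proof -
  have "x \<bullet> ((k + r *\<^sub>R (ctranspose V ** V) + t *\<^sub>R B) *v x)
      = x \<bullet> (k *v x) + r * ((V *v x) \<bullet> (V *v x))"
    by (simp add: matrix_vector_mult_add_rdistrib scaleR_matrix_vector inner_add_right inner_gram
        inner_skew_hermitian[OF assms(2)])
  then show ?thesis using assms(1)[of x] assms(3) by (simp add: add_increasing2)
qed

text \<open>With \<open>L = J' ** k\<close>, sandwiching
  \<open>2 *\<^sub>R (J + ctranspose J)\<close> between \<open>ctranspose L\<close> and
  \<open>L\<close> produces exactly the two cross terms that get subtracted, which leaves
  \<open>k\<close>.\<close>

lemma cayley_constraint:
  fixes h :: "complex^'n^'n" and k J J' :: "complex^'p^'p" and X Z :: "complex^'p^'n"
  assumes herm: "ctranspose h = h" "ctranspose k = k" and J: "J ** J' = mat 1"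
    and X: "ctranspose X ** h ** X = k"
    and ZX: "ctranspose Z ** h ** X = 2 *\<^sub>R k"
    and ZZ: "ctranspose Z ** h ** Z = 2 *\<^sub>R (J + ctranspose J)"
  shows "ctranspose (Z ** J' ** k - X) ** h ** (Z ** J' ** k - X) = k"
proof -
  define L where "L = J' ** k"
  have JL: "J ** L = k" by (simp add: L_def matrix_mul_assoc J)
  then have LJ: "ctranspose L ** ctranspose J = k" by (metis ctranspose_mult herm(2))
  have XZ: "ctranspose X ** h ** Z = 2 *\<^sub>R k"
    using arg_cong[OF ZX, of ctranspose] by (simp add: ctranspose_mult ctranspose_scaleR herm matrix_mul_assoc)
  have Y: "Z ** J' ** k = Z ** L" by (simp add: L_def matrix_mul_assoc)
  have "ctranspose (Z ** L - X) ** h ** (Z ** L - X)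
      = ctranspose L ** (ctranspose Z ** h ** Z) ** L - ctranspose L ** (ctranspose Z ** h ** X)
        - (ctranspose X ** h ** Z) ** L + ctranspose X ** h ** X"
    by (simp add: ctranspose_diff ctranspose_mult matrix_mult_simps matrix_mul_assoc)
  also have "\<dots> = 2 *\<^sub>R (ctranspose L ** (J ** L)) + 2 *\<^sub>R ((ctranspose L ** ctranspose J) ** L)
        - 2 *\<^sub>R (ctranspose L ** k) - 2 *\<^sub>R (k ** L) + k"
    unfolding ZZ ZX XZ X by (simp add: matrix_mult_simps matrix_mul_assoc scaleR_add_right)
  also have "\<dots> = k" unfolding JL LJ by simp
  finally show ?thesis unfolding Y .
qed

text \<open>\<open>J' \<tau>\<close> is the inverse of \<open>k + \<tau> *\<^sub>R C \<tau>\<close>.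
  The uniform lower bound keeps these inverses bounded, so they converge to \<open>k'\<close> and
  the difference quotient of the curve has an explicit limit.\<close>

lemma cayley_derivative:
  fixes k :: "complex^'p^'p" and X W :: "complex^'p^'n"
    and C J' :: "real \<Rightarrow> complex^'p^'p"
  assumes lower: "\<And>\<tau> x. m * norm x \<le> norm ((k + \<tau> *\<^sub>R C \<tau>) *v x)" "m > 0"
    and inv: "\<And>\<tau>. (k + \<tau> *\<^sub>R C \<tau>) ** J' \<tau> = mat 1" "\<And>\<tau>. J' \<tau> ** (k + \<tau> *\<^sub>R C \<tau>) = mat 1"
    and k: "k' ** k = mat 1" and C: "(C \<longlongrightarrow> c) (at 0)"
  shows "((\<lambda>\<tau>. (2 *\<^sub>R X + \<tau> *\<^sub>R W) ** J' \<tau> ** k - X) has_vector_derivative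
    W - 2 *\<^sub>R (X ** k' ** c)) (at 0)"
proof -
  note tendsto_mult = bounded_bilinear.tendsto[OF bounded_bilinear_matrix_mult]
  \<comment> \<open>Multiplying by the identity converts the operator bound on the inverse into a
    Frobenius bound independent of \<open>\<tau>\<close>.\<close>
  have bd: "norm (J' \<tau>) \<le> 1 / m * norm (mat 1 :: complex^'p^'p)" for \<tau>
  proof -
    have "norm (J' \<tau> *v y) \<le> 1 / m * norm y" for y
      using lower(1)[of "J' \<tau> *v y" \<tau>] lower(2)
      by (simp add: matrix_vector_mul_assoc inv field_simps)
    from norm_mult_left_le[OF this, of "mat 1"] show ?thesis using lower(2) by simp
  qed
  have J'_eq: "J' \<tau> = k' - \<tau> *\<^sub>R (k' ** C \<tau> ** J' \<tau>)" for \<tau>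
  proof -
    have "k' = k' ** ((k + \<tau> *\<^sub>R C \<tau>) ** J' \<tau>)" by (simp add: inv)
    also have "\<dots> = J' \<tau> + \<tau> *\<^sub>R (k' ** C \<tau> ** J' \<tau>)"
      by (simp add: matrix_mult_simps matrix_mul_assoc k)
    finally show ?thesis by (simp add: algebra_simps)
  qed
  have "((\<lambda>\<tau>. \<tau> *\<^sub>R (k' ** C \<tau> ** J' \<tau>)) \<longlongrightarrow> 0) (at 0)"
  proof (rule Lim_null_comparison)
    let ?b = "\<lambda>\<tau>. \<bar>\<tau>\<bar> * (norm (k' ** C \<tau>) * (1 / m * norm (mat 1 :: complex^'p^'p)))"
    have "norm (\<tau> *\<^sub>R (k' ** C \<tau> ** J' \<tau>)) \<le> ?b \<tau>" for \<tau>
      unfolding norm_scaleR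
      by (intro mult_left_mono order_trans[OF norm_matrix_mult_le mult_left_mono[OF bd norm_ge_zero]]) simp
    then show "\<forall>\<^sub>F \<tau> in at 0. norm (\<tau> *\<^sub>R (k' ** C \<tau> ** J' \<tau>)) \<le> ?b \<tau>" by simp
    have "(?b \<longlongrightarrow> \<bar>0\<bar> * (norm (k' ** c) * (1 / m * norm (mat 1 :: complex^'p^'p)))) (at 0)"
      by (intro tendsto_intros tendsto_mult C)
    then show "(?b \<longlongrightarrow> 0) (at 0)" by simp
  qed
  then have "((\<lambda>\<tau>. k' - \<tau> *\<^sub>R (k' ** C \<tau> ** J' \<tau>)) \<longlongrightarrow> k' - 0) (at 0)"
    by (intro tendsto_intros)
  then have J': "(J' \<longlongrightarrow> k') (at 0)" by (simp flip: J'_eq)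
  \<comment> \<open>The difference quotient written without division: the curve equals
    \<open>X + \<tau> *\<^sub>R Q \<tau>\<close>.\<close>
  define Q where "Q \<tau> = W - (2 *\<^sub>R X + \<tau> *\<^sub>R W) ** J' \<tau> ** C \<tau>" for \<tau>
  have "(Q \<longlongrightarrow> W - (2 *\<^sub>R X + 0 *\<^sub>R W) ** k' ** c) (at 0)"
    unfolding Q_def by (intro tendsto_intros tendsto_mult J' C)
  then have Q: "(Q \<longlongrightarrow> W - 2 *\<^sub>R (X ** k' ** c)) (at 0)"
    by (simp add: matrix_mult_simps)
  let ?Y = "\<lambda>\<tau>. (2 *\<^sub>R X + \<tau> *\<^sub>R W) ** J' \<tau> ** k - X"
  have Y: "?Y \<tau> = X + \<tau> *\<^sub>R Q \<tau>" for \<tau>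
  proof -
    have "J' \<tau> ** k = J' \<tau> ** (k + \<tau> *\<^sub>R C \<tau>) - \<tau> *\<^sub>R (J' \<tau> ** C \<tau>)"
      by (simp add: matrix_mult_simps)
    then have "J' \<tau> ** k = mat 1 - \<tau> *\<^sub>R (J' \<tau> ** C \<tau>)" by (simp only: inv)
    then have "?Y \<tau> = (2 *\<^sub>R X + \<tau> *\<^sub>R W) ** (mat 1 - \<tau> *\<^sub>R (J' \<tau> ** C \<tau>)) - X"
      by (simp flip: matrix_mul_assoc)
    also have "\<dots> = X + \<tau> *\<^sub>R Q \<tau>"
      by (simp add: Q_def matrix_mult_simps matrix_mul_assoc algebra_simps scaleR_2)
    finally show ?thesis .
  qed
  let ?q = "W - 2 *\<^sub>R (X ** k' ** c)"
  have "((\<lambda>\<tau>. norm (Q \<tau> - ?q)) \<longlongrightarrow> 0) (at 0)"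
    using tendsto_norm[OF tendsto_diff[OF Q tendsto_const[of ?q]]] by simp
  moreover have "\<forall>\<^sub>F \<tau> in at 0. norm (Q \<tau> - ?q)
      = norm (?Y (0 + \<tau>) - ?Y 0 - \<tau> *\<^sub>R ?q) / norm \<tau>"
  proof -
    have "norm (Q \<tau> - ?q) = norm (?Y (0 + \<tau>) - ?Y 0 - \<tau> *\<^sub>R ?q) / norm \<tau>" if "\<tau> \<noteq> 0" for \<tau>
    proof -
      have "?Y (0 + \<tau>) - ?Y 0 - \<tau> *\<^sub>R ?q = \<tau> *\<^sub>R (Q \<tau> - ?q)"
        unfolding Y by (simp add: scaleR_diff_right)
      then show ?thesis using that by simp
    qed
    then show ?thesis by (simp add: eventually_at_filter)
  qed
  ultimately have "((\<lambda>\<tau>. norm (?Y (0 + \<tau>) - ?Y 0 - \<tau> *\<^sub>R ?q) / norm \<tau>) \<longlongrightarrow> 0) (at 0)"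
    by (rule Lim_transform_eventually)
  then show ?thesis
    unfolding has_vector_derivative_def has_derivative_at
    by (intro conjI bounded_linear_scaleR_left)
qed

text \<open>Meant for \<open>R = S ** X\<close>, \<open>E = S ** D\<close>,
  \<open>V = S ** W\<close> with \<open>S\<close> the root of \<open>H\<close>, so that
  \<open>H\<close> is absorbed into Gram products. The bound is the quotient of an upper and a lower
  stretch factor of \<open>J\<close>.\<close>

lemma cond_cayley_le:
  fixes k k' J :: "complex^'p^'p" and R E V :: "complex^'p^'n" and \<tau> :: real
  assumes k: "ctranspose R ** R = k" and inv: "k ** k' = mat 1" "k' ** k = mat 1"
    and pos: "\<And>x. x \<noteq> 0 \<Longrightarrow> x \<bullet> (k *v x) > 0"
    and V: "V = R ** k' ** ctranspose R ** E - E"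
    and skew: "ctranspose (ctranspose R ** E) = - (ctranspose R ** E)"
    and \<tau>: "\<tau> \<ge> 0"
    and J: "J = k + (\<tau>\<^sup>2 / 4) *\<^sub>R (ctranspose V ** V) + (\<tau> / 2) *\<^sub>R (ctranspose R ** E)"
    and \<upsilon>: "\<upsilon> = \<tau> * norm E / sqrt (spectral_norm k)"
  shows "cond J \<le> (5 + \<upsilon>\<^sup>2) / 4 * cond k"
proof -
  define s where "s = spectral_norm k"
  have herm: "ctranspose k = k" by (simp add: k[symmetric] ctranspose_mult)
  obtain v where v: "norm v = 1" "k *v v = lambda_min k *\<^sub>R v"
    and rayleigh: "\<And>x. lambda_min k * (norm x)\<^sup>2 \<le> x \<bullet> (k *v x)"
    using hermitian_extreme_eigenvectors[OF herm] by metis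
  define m where "m = lambda_min k"
  have "v \<noteq> 0" using v(1) by force
  then have m: "m > 0" using pos[of v] v by (simp add: m_def dot_square_norm)
  \<comment> \<open>Compare an arbitrary \<open>x\<close> with the unit eigenvector
    \<open>v\<close>, where \<open>norm (k *v v) = m\<close>.\<close>
  have s_le: "s \<le> cond k * m"
  proof -
    have "norm (k *v x) \<le> cond k * m * norm x" for x
      using norm_le_cond[of k x v] pos v m by (fastforce simp: m_def[symmetric])
    then show ?thesis unfolding s_def spectral_norm_def by (rule onorm_le)
  qed
  have s: "s > 0"
    using norm_le_spectral_norm[of k v] v m by (simp add: s_def m_def)
  \<comment> \<open>\<open>Q\<close> is the orthogonal projection of \<open>E\<close> onto the range
    of \<open>R\<close> and \<open>V = Q - E\<close>. Hence \<open>ctranspose R ** V = 0\<close> and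
    \<open>Q\<close> is orthogonal to \<open>V\<close>.\<close>
  define Q where "Q = R ** k' ** ctranspose R ** E"
  have RQ: "ctranspose R ** Q = ctranspose R ** E"
    by (simp add: Q_def matrix_mul_assoc k inv)
  have "Q \<bullet> V = (R ** (k' ** ctranspose R ** E)) \<bullet> V" by (simp add: Q_def matrix_mul_assoc)
  also have "\<dots> = 0"
    unfolding inner_mult_matrix by (simp add: V matrix_mult_simps RQ flip: Q_def)
  finally have "Q \<bullet> V = 0" .
  \<comment> \<open>Bounding both terms of \<open>J\<close> by \<open>norm E\<close> alone would only give the constant \<open>(5 + 2 \<upsilon>\<^sup>2) / 4\<close>.\<close>
  then have E: "(norm E)\<^sup>2 = (norm Q)\<^sup>2 + (norm V)\<^sup>2"
  proof -
    have "E = Q - V" by (simp add: V Q_def)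
    then show ?thesis using \<open>Q \<bullet> V = 0\<close>
      by (simp add: power2_norm_eq_inner inner_diff_left inner_diff_right inner_commute)
  qed
  have R: "norm (R *v x) \<le> sqrt s * norm x" for x
  proof (rule power2_le_imp_le)
    have "(norm (R *v x))\<^sup>2 = x \<bullet> (k *v x)"
      by (simp add: k[symmetric] inner_gram dot_square_norm)
    also have "\<dots> \<le> norm x * (s * norm x)"
      unfolding s_def by (intro order_trans[OF norm_cauchy_schwarz] mult_left_mono norm_le_spectral_norm) simp
    also have "\<dots> = (sqrt s * norm x)\<^sup>2"
      using s by (simp add: power_mult_distrib power2_eq_square)
    finally show "(norm (R *v x))\<^sup>2 \<le> (sqrt s * norm x)\<^sup>2" .
  qed (use s in simp)
  have s0: "sqrt s \<ge> 0" using s by simp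
  have upper: "norm (J *v x) \<le> (5 + \<upsilon>\<^sup>2) / 4 * s * norm x" for x
  proof -
    have 1: "norm (k *v x) \<le> s * norm x" unfolding s_def by (rule norm_le_spectral_norm)
    have 2: "norm ((ctranspose V ** V) *v x) \<le> (norm V)\<^sup>2 * norm x"
    proof -
      have "norm (ctranspose V *v (V *v x)) \<le> norm V * (norm V * norm x)"
        using norm_matrix_vector_le[of "ctranspose V" "V *v x"]
          mult_left_mono[OF norm_matrix_vector_le[of V x] norm_ge_zero[of V]] by simp
      then show ?thesis by (simp add: matrix_vector_mul_assoc power2_eq_square mult.assoc)
    qed
    have 3: "norm ((ctranspose R ** E) *v x) \<le> sqrt s * norm Q * norm x"
    proof -
      have "norm (ctranspose R *v (Q *v x)) \<le> sqrt s * (norm Q * norm x)"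
        using norm_ctranspose_vector_le[OF R s0, of "Q *v x"]
          mult_left_mono[OF norm_matrix_vector_le[of Q x] s0] by simp
      then show ?thesis by (simp add: matrix_vector_mul_assoc RQ mult.assoc)
    qed
    have "norm (J *v x) \<le> norm (k *v x) + \<tau>\<^sup>2 / 4 * norm ((ctranspose V ** V) *v x)
        + \<tau> / 2 * norm ((ctranspose R ** E) *v x)"
      unfolding J matrix_vector_mult_add_rdistrib scaleR_matrix_vector
      by (intro order_trans[OF norm_triangle_ineq] add_mono) (use \<tau> in \<open>auto intro: norm_triangle_le\<close>)
    also have "\<dots> \<le> s * norm x + \<tau>\<^sup>2 / 4 * ((norm V)\<^sup>2 * norm x) + \<tau> / 2 * (sqrt s * norm Q * norm x)"
      by (intro add_mono mult_left_mono 1 2 3) (use \<tau> in auto)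
    also have "\<dots> = (s + \<tau>\<^sup>2 / 4 * (norm V)\<^sup>2 + \<tau> / 2 * sqrt s * norm Q) * norm x"
      by (simp add: algebra_simps)
    also have "\<dots> \<le> (5 + \<upsilon>\<^sup>2) / 4 * s * norm x"
    proof (intro mult_right_mono)
      \<comment> \<open>AM-GM on \<open>sqrt s\<close> and \<open>\<tau> * norm Q\<close>: the mixed
        term costs \<open>s / 4\<close>, whence 5 = 4 + 1, and a quarter of the squared
        \<open>\<tau> * norm Q\<close>, which joins the \<open>V\<close> term by Pythagoras.\<close>
      have "0 \<le> (sqrt s - \<tau> * norm Q)\<^sup>2" by simp
      then have "2 * \<tau> * sqrt s * norm Q \<le> s + \<tau>\<^sup>2 * (norm Q)\<^sup>2"
        using s by (simp add: power2_diff power_mult_distrib algebra_simps)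
      moreover have "s * \<upsilon>\<^sup>2 = \<tau>\<^sup>2 * (norm E)\<^sup>2"
        using s by (simp add: \<upsilon> s_def[symmetric] power_mult_distrib power_divide)
      then have "s * \<upsilon>\<^sup>2 = \<tau>\<^sup>2 * (norm Q)\<^sup>2 + \<tau>\<^sup>2 * (norm V)\<^sup>2"
        by (simp add: E distrib_left)
      ultimately show "s + \<tau>\<^sup>2 / 4 * (norm V)\<^sup>2 + \<tau> / 2 * sqrt s * norm Q \<le> (5 + \<upsilon>\<^sup>2) / 4 * s"
        by (simp add: algebra_simps)
    qed simp
    finally show ?thesis .
  qed
  have "m * norm x \<le> norm (J *v x)" for x
    unfolding J using \<tau> by (intro norm_lower_bound perturbed_rayleigh[OF _ skew]) (auto simp: m_def rayleigh)
  then have "cond J \<le> (5 + \<upsilon>\<^sup>2) / 4 * s / m"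
    using m upper by (intro cond_le)
  also have "\<dots> = (5 + \<upsilon>\<^sup>2) / 4 * (s / m)" by simp
  also have "\<dots> \<le> (5 + \<upsilon>\<^sup>2) / 4 * cond k"
    using s_le m by (intro mult_left_mono) (auto simp: field_simps)
  finally show ?thesis .
qed

text \<open>Moving factors across the inner product leaves
  \<open>B \<bullet> B - B \<bullet> ctranspose B\<close>. As \<open>B\<close> and its adjoint have
  equal norms, this is half the squared norm of their difference \<open>A\<close>.\<close>

lemma inner_skew_gradient:
  fixes h A :: "complex^'n^'n" and X G :: "complex^'p^'n"
  assumes h: "ctranspose h = h" and A: "A = G ** ctranspose X ** h - h ** X ** ctranspose G"
  shows "(A ** h ** X) \<bullet> G = (norm A)\<^sup>2 / 2"
proof -
  define B where "B = G ** ctranspose X ** h"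
  have B': "h ** X ** ctranspose G = ctranspose B"
    by (simp add: B_def ctranspose_mult h matrix_mul_assoc)
  have "(A ** h ** X) \<bullet> G = ctranspose G \<bullet> ctranspose (A ** h ** X)"
    by (simp add: inner_ctranspose inner_commute)
  also have "\<dots> = (h ** X ** ctranspose G) \<bullet> ctranspose A"
    by (simp add: inner_mult_matrix[of "h ** X"] ctranspose_mult h matrix_mul_assoc)
  also have "\<dots> = B \<bullet> B - B \<bullet> ctranspose B"
    by (simp add: A B_def[symmetric] B' ctranspose_diff inner_diff_right inner_ctranspose inner_commute)
  also have "\<dots> = (norm A)\<^sup>2 / 2"
    by (simp add: A B_def[symmetric] B' power2_norm_eq_inner inner_diff_left inner_diff_right
        inner_ctranspose inner_commute)
  finally show ?thesis .
qed

section \<open>The constraint, the slope and the conditioning for the given curve\<close>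

theorem lemma5p2:
  fixes H :: "real^'n^'n" and K :: "real^'p^'p"
    and F :: "complex^'p^'n \<Rightarrow> real"
    and X G D gradF W :: "complex^'p^'n"
    and J :: "real \<Rightarrow> complex^'p^'p"
    and Y :: "real \<Rightarrow> complex^'p^'n"
    and \<upsilon> :: "real \<Rightarrow> real"
  assumes H: "sym_psd H"
    and K: "sym_pd K"
    and F: "\<forall>Z. F differentiable (at Z)"
    and G: "GDERIV F X :> G"
    and X: "ctranspose X ** cmat H ** X = cmat K"
    and D: "D = G ** ctranspose X ** cmat H ** cmat H ** X
                - cmat H ** X ** ctranspose G ** cmat H ** X"
    and gradF: "gradF = G - cmat H ** X ** ctranspose G ** X ** matrix_inv (cmat K)"
    and W: "W = - ((mat 1 - X ** matrix_inv (cmat K) ** ctranspose X ** cmat H) ** D)"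
    and J: "J = (\<lambda>\<tau>. cmat K + (\<tau>\<^sup>2 / 4) *\<^sub>R (ctranspose W ** cmat H ** W)
                + (\<tau> / 2) *\<^sub>R (ctranspose X ** cmat H ** D))"
    and Y: "Y = (\<lambda>\<tau>. (2 *\<^sub>R X + \<tau> *\<^sub>R W) ** matrix_inv (J \<tau>) ** cmat K - X)"
    and \<upsilon>: "\<upsilon> = (\<lambda>\<tau>. \<tau> * norm (cmat (psd_sqrt H) ** D) / sqrt (spectral_norm (cmat K)))"
  shows "(\<forall>\<tau>\<ge>0. ctranspose (Y \<tau>) ** cmat H ** Y \<tau> = cmat K)
    \<and> ((Y has_vector_derivative (- D)) (at 0)
       \<and> (gradF \<noteq> 0 \<longrightarrow> descent_direction F X (- D))
       \<and> (\<exists>d. ((\<lambda>\<tau>. F (Y \<tau>)) has_real_derivative d) (at 0)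
              \<and> d \<le> - (1 / 2) * (1 / (spectral_norm (X ** matrix_inv (cmat K)))\<^sup>2) * (norm gradF)\<^sup>2))
    \<and> (\<forall>\<tau>\<ge>0. cond (J \<tau>) \<le> (5 + (\<upsilon> \<tau>)\<^sup>2) / 4 * cond (cmat K))"
proof -
  define h k k' S where "h = cmat H" and "k = cmat K" and "k' = matrix_inv k" and "S = cmat (psd_sqrt H)"
  note defs = h_def[symmetric] k_def[symmetric] k'_def[symmetric] S_def[symmetric]
  note [unfolded defs] = X D gradF W J Y \<upsilon>
  note X = this(1) and D = this(2) and gradF = this(3) and W = this(4) and J = this(5)
    and Y = this(6) and \<upsilon> = this(7)
  have h: "ctranspose h = h" using H by (simp add: h_def ctranspose_cmat sym_psd_def)
  have k: "ctranspose k = k" using K by (simp add: k_def ctranspose_cmat sym_pd_def)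
  have S: "ctranspose S = S" "S ** S = h"
    using psd_sqrt[OF H] by (simp_all add: S_def h_def ctranspose_cmat sym_psd_def flip: cmat_mult)
  have pos: "x \<bullet> (k *v x) > 0" if "x \<noteq> 0" for x
    unfolding k_def using K that by (rule inner_cmat_pos)
  then have "\<forall>x. k *v x = 0 \<longrightarrow> x = 0"
    by (metis inner_zero_right less_irrefl)
  from matrix_inv_inverse[OF this] have k': "k ** k' = mat 1" "k' ** k = mat 1"
    unfolding k'_def .
  \<comment> \<open>The root \<open>S\<close> turns products weighted by \<open>h\<close> into the
    plain Gram form that the bounds on \<open>J\<close> require.\<close>
  have rearrange: "ctranspose Z ** h ** Z' = ctranspose (S ** Z) ** (S ** Z')" for Z Z' :: "complex^'p^'n"
    by (simp add: ctranspose_mult S matrix_mul_assoc flip: S(2))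
  define A where "A = G ** ctranspose X ** h - h ** X ** ctranspose G"
  have DA: "D = A ** h ** X"
    by (simp add: D A_def matrix_mult_simps matrix_mul_assoc)
  have A: "ctranspose A = - A"
    by (simp add: A_def ctranspose_diff ctranspose_mult h matrix_mul_assoc)
  have skew: "ctranspose (ctranspose X ** h ** D) = - (ctranspose X ** h ** D)"
    by (simp add: DA ctranspose_mult h A matrix_mult_simps matrix_mul_assoc)
  have gradF_A: "gradF = A ** (X ** k')"
  proof -
    \<comment> \<open>Inserting \<open>k ** k'\<close> after \<open>G\<close>, with \<open>k\<close>
      written as \<open>ctranspose X ** h ** X\<close>, exposes the common right factor
      \<open>X ** k'\<close>.\<close>
    have "G ** (ctranspose X ** h ** X) ** k' = G"
      unfolding X by (simp add: k' flip: matrix_mul_assoc)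
    then show ?thesis by (simp add: gradF A_def matrix_mult_simps matrix_mul_assoc)
  qed
  define C where "C \<tau> = (\<tau> / 4) *\<^sub>R (ctranspose W ** h ** W) + (1 / 2) *\<^sub>R (ctranspose X ** h ** D)" for \<tau>
  have JC: "J \<tau> = k + \<tau> *\<^sub>R C \<tau>" for \<tau>
    by (simp add: J C_def scaleR_add_right power2_eq_square)
  obtain v where v: "norm v = 1" "k *v v = lambda_min k *\<^sub>R v"
    and rayleigh: "\<And>x. lambda_min k * (norm x)\<^sup>2 \<le> x \<bullet> (k *v x)"
    using hermitian_extreme_eigenvectors[OF k] by metis
  have m: "lambda_min k > 0"
    using pos[of v] v by (force simp: dot_square_norm)
  \<comment> \<open>The Gram term carries the square of \<open>\<tau>\<close>, so the bound also
    holds for negative \<open>\<tau>\<close>, as the two-sided derivative at 0 requires.\<close>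
  have lower: "lambda_min k * norm x \<le> norm (J \<tau> *v x)" for \<tau> x
    unfolding J rearrange[of W W]
    by (intro norm_lower_bound perturbed_rayleigh[OF rayleigh skew]) simp
  have "\<forall>x. J \<tau> *v x = 0 \<longrightarrow> x = 0" for \<tau>
    using lower m by (metis mult_pos_pos norm_zero not_le zero_less_norm_iff)
  from matrix_inv_inverse[OF this]
  have J': "J \<tau> ** matrix_inv (J \<tau>) = mat 1" "matrix_inv (J \<tau>) ** J \<tau> = mat 1" for \<tau> .
  have XhW: "ctranspose X ** h ** W = 0"
  proof -
    have "ctranspose X ** h ** W = (ctranspose X ** h ** X) ** k' ** ctranspose X ** h ** D
        - ctranspose X ** h ** D"
      by (simp add: W matrix_mult_simps matrix_mul_assoc)
    then show ?thesis by (simp add: X k')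
  qed
  then have WhX: "ctranspose W ** h ** X = 0"
    using arg_cong[OF XhW, of ctranspose] by (simp add: ctranspose_mult h matrix_mul_assoc vec_eq_iff)
  have constraint: "ctranspose (Y \<tau>) ** h ** Y \<tau> = k" for \<tau>
    unfolding Y
  proof (rule cayley_constraint[OF h k J'(1) X])
    have tr: "ctranspose (2 *\<^sub>R X + \<tau> *\<^sub>R W) = 2 *\<^sub>R ctranspose X + \<tau> *\<^sub>R ctranspose W"
      by (simp add: ctranspose_add ctranspose_scaleR)
    show "ctranspose (2 *\<^sub>R X + \<tau> *\<^sub>R W) ** h ** X = 2 *\<^sub>R k"
      by (simp add: tr matrix_mult_simps X WhX)
    have "ctranspose (2 *\<^sub>R X + \<tau> *\<^sub>R W) ** h ** (2 *\<^sub>R X + \<tau> *\<^sub>R W)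
        = 4 *\<^sub>R k + \<tau>\<^sup>2 *\<^sub>R (ctranspose W ** h ** W)"
      by (simp add: tr matrix_mult_simps X WhX XhW power2_eq_square)
    also have "\<dots> = 2 *\<^sub>R (J \<tau> + ctranspose (J \<tau>))"
    proof -
      have "ctranspose (J \<tau>) = k + (\<tau>\<^sup>2 / 4) *\<^sub>R (ctranspose W ** h ** W) - (\<tau> / 2) *\<^sub>R (ctranspose X ** h ** D)"
        unfolding J ctranspose_add ctranspose_scaleR skew k
        by (simp add: ctranspose_mult h matrix_mul_assoc)
      then have "J \<tau> + ctranspose (J \<tau>) = 2 *\<^sub>R k + (\<tau>\<^sup>2 / 2) *\<^sub>R (ctranspose W ** h ** W)"
        by (simp add: J scaleR_2 flip: scaleR_add_left)
      then show ?thesis by (simp add: scaleR_add_right)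
    qed
    finally show "ctranspose (2 *\<^sub>R X + \<tau> *\<^sub>R W) ** h ** (2 *\<^sub>R X + \<tau> *\<^sub>R W)
        = 2 *\<^sub>R (J \<tau> + ctranspose (J \<tau>))" .
  qed
  have "(C \<longlongrightarrow> (0 / 4) *\<^sub>R (ctranspose W ** h ** W) + (1 / 2) *\<^sub>R (ctranspose X ** h ** D)) (at 0)"
    unfolding C_def by (intro tendsto_intros) simp
  then have C: "(C \<longlongrightarrow> (1 / 2) *\<^sub>R (ctranspose X ** h ** D)) (at 0)" by simp
  have "(Y has_vector_derivative W - 2 *\<^sub>R (X ** k' ** ((1 / 2) *\<^sub>R (ctranspose X ** h ** D)))) (at 0)"
    unfolding Y by (rule cayley_derivative[OF lower[unfolded JC] m J'[unfolded JC] k'(2) C, folded JC])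
  \<comment> \<open>\<open>W\<close> lacks the component of \<open>- D\<close> along the range of
    \<open>X\<close>; the derivative of the inverse of \<open>J\<close> supplies it.\<close>
  moreover have "W - 2 *\<^sub>R (X ** k' ** ((1 / 2) *\<^sub>R (ctranspose X ** h ** D))) = - D"
    by (simp add: W matrix_mult_simps matrix_mul_assoc)
  ultimately have Y': "(Y has_vector_derivative - D) (at 0)" by simp
  have "J 0 = k" by (simp add: J)
  then have Y0: "Y 0 = X"
    by (simp add: Y k' defs flip: matrix_mul_assoc) (simp add: scaleR_2)
  have F': "(F has_derivative (\<lambda>\<Delta>. \<Delta> \<bullet> G)) (at X)"
    using G by (simp add: gderiv_def)
  \<comment> \<open>Stated for any curve through \<open>X\<close> with velocity \<open>- D\<close>,
    since it serves both \<open>Y\<close> and the straight line in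
    \<open>descent_direction\<close>.\<close>
  have slope: "((\<lambda>\<tau>. F (c \<tau>)) has_real_derivative - (D \<bullet> G)) (at 0)"
    if "(c has_vector_derivative - D) (at 0)" "c 0 = X" for c
  proof -
    have "((\<lambda>\<tau>. F (c \<tau>)) has_derivative (\<lambda>\<tau>. (\<tau> *\<^sub>R (- D)) \<bullet> G)) (at 0)"
      using that F' unfolding has_vector_derivative_def
      by (intro has_derivative_compose[of c _ 0 UNIV F "\<lambda>\<Delta>. \<Delta> \<bullet> G"]) auto
    then show ?thesis
      by (rule has_derivative_imp_has_field_derivative) simp
  qed
  have DG: "D \<bullet> G = (norm A)\<^sup>2 / 2"
    unfolding DA using h A_def by (rule inner_skew_gradient)
  have descent: "descent_direction F X (- D)" if "gradF \<noteq> 0"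
  proof -
    have "A \<noteq> 0" using that gradF_A by force
    then have "- (D \<bullet> G) < 0" by (simp add: DG)
    moreover have "((\<lambda>t. X + t *\<^sub>R (- D)) has_vector_derivative - D) (at 0)"
      by (auto intro!: derivative_eq_intros)
    ultimately show ?thesis
      unfolding descent_direction_def by (intro exI[of _ "- (D \<bullet> G)"] conjI slope) auto
  qed
  have "- (D \<bullet> G) \<le> - (1 / 2) * (1 / (spectral_norm (X ** k'))\<^sup>2) * (norm gradF)\<^sup>2"
  proof -
    have "(norm gradF)\<^sup>2 \<le> (norm A)\<^sup>2 * (spectral_norm (X ** k'))\<^sup>2"
      using power_mono[OF norm_mult_right_le[of A "X ** k'"] norm_ge_zero, of 2]
      by (simp add: gradF_A power_mult_distrib)
    \<comment> \<open>If the spectral norm is 0, the quotient is 0 by the convention for division by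
      zero; otherwise the denominator is cleared.\<close>
    then have "(norm gradF)\<^sup>2 / (spectral_norm (X ** k'))\<^sup>2 \<le> (norm A)\<^sup>2"
      by (cases "spectral_norm (X ** k') = 0") (simp_all add: divide_le_eq)
    then show ?thesis by (simp add: DG)
  qed
  with slope[OF Y' Y0] have rate: "\<exists>d. ((\<lambda>\<tau>. F (Y \<tau>)) has_real_derivative d) (at 0)
      \<and> d \<le> - (1 / 2) * (1 / (spectral_norm (X ** k'))\<^sup>2) * (norm gradF)\<^sup>2" by blast
  have "cond (J \<tau>) \<le> (5 + (\<upsilon> \<tau>)\<^sup>2) / 4 * cond k" if "\<tau> \<ge> 0" for \<tau>
  proof (rule cond_cayley_le[where R = "S ** X" and E = "S ** D" and V = "S ** W" and k' = k' and \<tau> = \<tau>, OF _ k' pos])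
    show "S ** W = S ** X ** k' ** ctranspose (S ** X) ** (S ** D) - S ** D"
      by (simp add: W ctranspose_mult S matrix_mult_simps matrix_mul_assoc flip: S(2))
  qed (use that X skew in \<open>simp_all add: J \<upsilon> rearrange\<close>)
  with constraint Y' descent rate show ?thesis
    by (simp only: defs) blast
qed

end
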